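(* Let $(\mathfrak g,\cdot_{\mathfrak g},\omega)$ be a quadratic pre-Lie algebra and $N$ a Nijenhuis operator on $(\mathfrak g,\cdot_{\mathfrak g})$. Then $(\mathfrak g,\cdot_{\mathfrak g},\omega,N)$ is a para-complex quadratic pre-Lie algebra if and only if there exist two isotropic pre-Lie subalgebras $\mathfrak g^+$ and $\mathfrak g^-$ (with respect to the quadratic structure $\omega$) of the quadratic pre-Lie algebra $(\mathfrak g,\cdot_{\mathfrak g},\omega)$ such that $\dim(\mathfrak g^+)=\dim(\mathfrak g^-)$ and $\mathfrak g=\mathfrak g^+\oplus\mathfrak g^-$ as the direct sum of vector spaces.
   Context: $\mathbb K$ is an algebraically closed field of characteristic $0$; vector spaces are finite dimensional over $\mathbb K$. A pre-Lie algebra is a vector space $\mathfrak g$ with a bilinear product $\cdot_{\mathfrak g}$ such that $(x\cdot_{\mathfrak g} y)\cdot_{\mathfrak g} z-x\cdot_{\mathfrak g}(y\cdot_{\mathfrak g} z)$ is symmetric in $x,y$; $[x,y]^c=x\cdot_{\mathfrak g}y-y\cdot_{\mathfrak g}x$. A quadratic pre-Lie algebra $(\mathfrak g,\cdot_{\mathfrak g},\omega)$ is a pre-Lie algebra with a nondegenerate skew-symmetric bilinear form $\omega$ satisfying $\omega(x\cdot_{\mathfrak g}y,z)+\omega(y,[x,z]^c)=0$ for all $x,y,z\in\mathfrak g$. A Nijenhuis operator on $(\mathfrak g,\cdot_{\mathfrak g})$ is a linear map $N:\mathfrak g\to\mathfrak g$ with $N(x)\cdot_{\mathfrak g}N(y)=N\big(N(x)\cdot_{\mathfrak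 g}y+x\cdot_{\mathfrak g}N(y)-N(x\cdot_{\mathfrak g}y)\big)$ for all $x,y$. A para-complex structure on $(\mathfrak g,\cdot_{\mathfrak g})$ is a Nijenhuis operator $N$ with $N^2=\mathrm{Id}$ and $\dim\ker(N+\mathrm{Id})=\dim\ker(N-\mathrm{Id})$. $(\mathfrak g,\cdot_{\mathfrak g},\omega,N)$ is a para-complex quadratic pre-Lie algebra if $(\mathfrak g,\cdot_{\mathfrak g},\omega)$ is a quadratic pre-Lie algebra, $N$ is a para-complex structure on $(\mathfrak g,\cdot_{\mathfrak g})$ and $\omega(N(x),y)=-\omega(x,N(y))$ for all $x,y\in\mathfrak g$. A subspace $W$ is isotropic with respect to $\omega$ if $\omega(w,w')=0$ for all $w,w'\in W$.
   Formalization: The printed "if" fails for N = Id; instead it is proved that N is para-complex quadratic iff there is such a decomposition with N = Id on g+ and N = -Id on g-, and that some para-complex quadratic structure exists iff such a decomposition exists. *)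

theory Defs
  imports "HOL-Computational_Algebra.Polynomial"
begin

text \<open>
  The vector space is the whole type \<open>'v\<close>, with scalar multiplication \<open>scale\<close>.
\<close>

locale pre_lie_algebra = vector_space scale
  for scale :: "'k::field \<Rightarrow> 'v::ab_group_add \<Rightarrow> 'v" +
  fixes prd :: "'v \<Rightarrow> 'v \<Rightarrow> 'v"
  assumes linear_prd_left: "Vector_Spaces.linear scale scale (\<lambda>x. prd x y)"
    and linear_prd_right: "Vector_Spaces.linear scale scale (\<lambda>y. prd x y)"
    and associator_symmetric:
      "prd (prd x y) z - prd x (prd y z) = prd (prd y x) z - prd y (prd x z)"

definition commutator :: "('v::ab_group_add \<Rightarrow> 'v \<Rightarrow> 'v) \<Rightarrow> 'v \<Rightarrow> 'v \<Rightarrow> 'v" where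
  "commutator prd x y = prd x y - prd y x"

locale quadratic_pre_lie_algebra = pre_lie_algebra scale prd
  for scale :: "'k::field \<Rightarrow> 'v::ab_group_add \<Rightarrow> 'v"
    and prd :: "'v \<Rightarrow> 'v \<Rightarrow> 'v" +
  fixes \<omega> :: "'v \<Rightarrow> 'v \<Rightarrow> 'k"
  assumes linear_form_left: "Vector_Spaces.linear scale (*) (\<lambda>x. \<omega> x y)"
    and linear_form_right: "Vector_Spaces.linear scale (*) (\<lambda>y. \<omega> x y)"
    and skew_symmetric: "\<omega> x y = - \<omega> y x"
    and nondegenerate: "(\<And>y. \<omega> x y = 0) \<Longrightarrow> x = 0"
    and form_invariant: "\<omega> (prd x y) z + \<omega> y (commutator prd x z) = 0"

locale nijenhuis_operator = pre_lie_algebra scale prd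
  for scale :: "'k::field \<Rightarrow> 'v::ab_group_add \<Rightarrow> 'v"
    and prd :: "'v \<Rightarrow> 'v \<Rightarrow> 'v" +
  fixes N :: "'v \<Rightarrow> 'v"
  assumes linear_operator: "Vector_Spaces.linear scale scale N"
    and nijenhuis: "prd (N x) (N y) = N (prd (N x) y + prd x (N y) - N (prd x y))"

locale para_complex_structure = nijenhuis_operator scale prd N
  for scale :: "'k::field \<Rightarrow> 'v::ab_group_add \<Rightarrow> 'v"
    and prd :: "'v \<Rightarrow> 'v \<Rightarrow> 'v"
    and N :: "'v \<Rightarrow> 'v" +
  assumes involutive: "N (N x) = x"
    and dim_kernels: "dim {x. N x + x = 0} = dim {x. N x - x = 0}"

locale para_complex_quadratic_pre_lie_algebra =
  quadratic_pre_lie_algebra scale prd \<omega> + para_complex_structure scale prd N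
  for scale :: "'k::field \<Rightarrow> 'v::ab_group_add \<Rightarrow> 'v"
    and prd :: "'v \<Rightarrow> 'v \<Rightarrow> 'v"
    and \<omega> :: "'v \<Rightarrow> 'v \<Rightarrow> 'k"
    and N :: "'v \<Rightarrow> 'v" +
  assumes operator_skew: "\<omega> (N x) y = - \<omega> x (N y)"

definition pre_lie_subalgebra ::
  "('k::field \<Rightarrow> 'v::ab_group_add \<Rightarrow> 'v) \<Rightarrow> ('v \<Rightarrow> 'v \<Rightarrow> 'v) \<Rightarrow> 'v set \<Rightarrow> bool" where
  "pre_lie_subalgebra scale prd W \<longleftrightarrow>
     module.subspace scale W \<and> (\<forall>x\<in>W. \<forall>y\<in>W. prd x y \<in> W)"

definition isotropic :: "('v \<Rightarrow> 'v \<Rightarrow> 'k::field) \<Rightarrow> 'v set \<Rightarrow> bool" where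
  "isotropic \<omega> W \<longleftrightarrow> (\<forall>w\<in>W. \<forall>w'\<in>W. \<omega> w w' = 0)"

text \<open>
  A splitting does not refer to any operator. The operator associated with it acts as
  the identity on \<open>U\<close> and as minus the identity on \<open>V\<close>; for a fixed Nijenhuis operator
  this link has to be required explicitly, since e.g. the identity is always Nijenhuis.
\<close>

definition isotropic_splitting ::
  "('k::field \<Rightarrow> 'v::ab_group_add \<Rightarrow> 'v) \<Rightarrow> ('v \<Rightarrow> 'v \<Rightarrow> 'v) \<Rightarrow> ('v \<Rightarrow> 'v \<Rightarrow> 'k) \<Rightarrow>
     'v set \<Rightarrow> 'v set \<Rightarrow> bool" where
  "isotropic_splitting scale prd \<omega> U V \<longleftrightarrow>
     pre_lie_subalgebra scale prd U \<and> isotropic \<omega> U \<and>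
     pre_lie_subalgebra scale prd V \<and> isotropic \<omega> V \<and>
     vector_space.dim scale U = vector_space.dim scale V \<and>
     U \<inter> V = {0} \<and> {u + v | u v. u \<in> U \<and> v \<in> V} = UNIV"

end

theory Submission
  imports Defs
begin

text \<open>
  A para-complex structure is the same datum as a splitting into its two eigenspaces, for the
  eigenvalues 1 and -1. For an involution \<open>N\<close> and an eigenvalue \<open>s\<close> with \<open>s\<^sup>2 = 1\<close>, the Nijenhuis
  identity on two eigenvectors reads \<open>(N - s)\<^sup>2 (x y) = 0\<close>, and since \<open>N\<close> is diagonalizable this
  forces \<open>x y\<close> into the same eigenspace; compatibility of \<open>N\<close> with the form says that the
  eigenvalue changes sign when it moves across the form, so each eigenspace is isotropic
  (\<open>eigenspace_subalgebra\<close>, \<open>eigenspace_isotropic\<close>, \<open>eigenspaces_splitting\<close>).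

  Conversely, the operator that is 1 on one summand and -1 on the other (\<open>reflection_exists\<close>) is
  skew for the form because only the mixed values of the form survive, where the two
  eigenvalues are opposite. Its Nijenhuis identity is bilinear in the two arguments, so it can be
  checked on the summands: on a pair from one summand it is closure under the product, on a mixed
  pair it reduces to \<open>N\<^sup>2 = 1\<close> (\<open>reflection_para_complex\<close>).
\<close>

lemma (in vector_space) add_self_eq_0:
  fixes x :: 'b
  assumes "(2::'a) \<noteq> 0" and "x + x = 0"
  shows "x = 0"
proof -
  have "scale 2 x = scale (1 + 1) x"
    by (simp only: one_add_one)
  also have "\<dots> = x + x"
    by (simp only: scale_left_distrib scale_one)
  finally show ?thesis
    using assms by simp
qed

text \<open>
  With \<open>N\<^sup>2 = 1\<close> and \<open>s\<^sup>2 = 1\<close> the relation \<open>(N - s)\<^sup>2 (x y) = 0\<close> becomes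
  \<open>2 x y = 2 s N (x y)\<close>; this is where characteristic 2 has to be excluded.
\<close>

lemma eigenspace_subalgebra:
  fixes scale :: "'k::field \<Rightarrow> 'v::ab_group_add \<Rightarrow> 'v"
  assumes "nijenhuis_operator scale prd N" and inv: "\<And>x. N (N x) = x"
    and s: "s * s = 1" and two: "(2::'k) \<noteq> 0"
  shows "pre_lie_subalgebra scale prd {x. N x = scale s x}"
proof -
  interpret nijenhuis_operator scale prd N by fact
  interpret N: Vector_Spaces.linear scale scale N by (rule linear_operator)
  interpret L: Vector_Spaces.linear scale scale "\<lambda>x. prd x y" for y by (rule linear_prd_left)
  interpret R: Vector_Spaces.linear scale scale "\<lambda>y. prd x y" for x by (rule linear_prd_right)
  have "N (prd x y) = scale s (prd x y)" if "N x = scale s x" "N y = scale s y" for x y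
  proof -
    let ?p = "prd x y"
    have "?p = scale s (scale s ?p)"
      using s by simp
    also have "\<dots> = prd (N x) (N y)"
      by (simp add: that L.scale R.scale)
    also have "\<dots> = N (scale s ?p + scale s ?p - N ?p)"
      by (simp only: nijenhuis) (simp add: that L.scale R.scale)
    also have "\<dots> = scale s (N ?p) + scale s (N ?p) - ?p"
      by (simp add: N.add N.diff N.scale inv)
    finally have "(?p - scale s (N ?p)) + (?p - scale s (N ?p)) = 0"
      by (simp add: algebra_simps)
    from add_self_eq_0[OF two this] have "scale s ?p = scale s (scale s (N ?p))"
      by simp
    then show ?thesis
      using s by simp
  qed
  moreover have "subspace {x. N x = scale s x}"
    by (rule subspaceI)
      (auto simp: N.add N.scale scale_right_distrib mult.commute)
  ultimately show ?thesis
    by (simp add: pre_lie_subalgebra_def)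
qed

text \<open>
  Moving \<open>N\<close> across the form turns \<open>s \<omega>(x, y)\<close> into \<open>- s \<omega>(x, y)\<close>.
\<close>

lemma eigenspace_isotropic:
  fixes scale :: "'k::field \<Rightarrow> 'v::ab_group_add \<Rightarrow> 'v"
  assumes "quadratic_pre_lie_algebra scale prd \<omega>"
    and skew: "\<And>x y. \<omega> (N x) y = - \<omega> x (N y)"
    and "s \<noteq> 0" and "(2::'k) \<noteq> 0"
  shows "isotropic \<omega> {x. N x = scale s x}"
proof -
  interpret quadratic_pre_lie_algebra scale prd \<omega> by fact
  interpret l: Vector_Spaces.linear scale "(*)" "\<lambda>x. \<omega> x y" for y by (rule linear_form_left)
  interpret r: Vector_Spaces.linear scale "(*)" "\<lambda>y. \<omega> x y" for x by (rule linear_form_right)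
  have "\<omega> x y = 0" if "N x = scale s x" "N y = scale s y" for x y
  proof -
    have "s * \<omega> x y = - (s * \<omega> x y)"
      using skew[of x y] by (simp add: that l.scale r.scale)
    then have "2 * (s * \<omega> x y) = 0"
      by (simp only: mult_2) (simp add: eq_neg_iff_add_eq_0)
    then show ?thesis
      using assms(3,4) by simp
  qed
  then show ?thesis
    by (simp add: isotropic_def)
qed

lemma eigenspaces_splitting:
  fixes scale :: "'k::field \<Rightarrow> 'v::ab_group_add \<Rightarrow> 'v"
  assumes "para_complex_quadratic_pre_lie_algebra scale prd \<omega> N" and two: "(2::'k) \<noteq> 0"
  shows "isotropic_splitting scale prd \<omega> {x. N x = x} {x. N x = - x}"
proof -
  interpret para_complex_quadratic_pre_lie_algebra scale prd \<omega> N by fact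
  interpret N: Vector_Spaces.linear scale scale N by (rule linear_operator)
  have nij: "nijenhuis_operator scale prd N" and quad: "quadratic_pre_lie_algebra scale prd \<omega>"
    by unfold_locales
  note sub = eigenspace_subalgebra[OF nij involutive _ two]
  note iso = eigenspace_isotropic[OF quad operator_skew _ two]
  have plus: "{x. N x = scale 1 x} = {x. N x = x}"
    and minus: "{x. N x = scale (-1) x} = {x. N x = - x}"
    by simp_all
  have dims: "dim {x. N x = x} = dim {x. N x = - x}"
    using dim_kernels by (simp add: eq_neg_iff_add_eq_0)
  have int: "{x. N x = x} \<inter> {x. N x = - x} = {0}"
    by (auto simp: eq_neg_iff_add_eq_0 dest: add_self_eq_0[OF two])
  \<comment> \<open>\<open>(1 + N) / 2\<close> and \<open>(1 - N) / 2\<close> are the projections onto the two eigenspaces.\<close>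
  have "\<exists>u v. x = u + v \<and> N u = u \<and> N v = - v" for x
  proof (intro exI conjI)
    let ?h = "inverse 2 :: 'k"
    have half: "?h + ?h = 1"
      using two by (metis mult_2 right_inverse)
    have "scale ?h (x + N x) + scale ?h (x - N x) = scale ?h x + scale ?h x"
      by (simp add: scale_right_distrib scale_right_diff_distrib)
    also have "\<dots> = x"
      using half by (simp flip: scale_left_distrib)
    finally show "x = scale ?h (x + N x) + scale ?h (x - N x)" ..
    show "N (scale ?h (x + N x)) = scale ?h (x + N x)"
      by (simp add: N.scale N.add involutive add.commute)
    show "N (scale ?h (x - N x)) = - scale ?h (x - N x)"
      by (simp add: N.scale N.diff involutive flip: scale_minus_right)
  qed
  then have "{u + v | u v. u \<in> {x. N x = x} \<and> v \<in> {x. N x = - x}} = UNIV"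
    by auto
  then show ?thesis
    using sub[of 1] sub[of "-1"] iso[of 1] iso[of "-1"] dims int
    by (simp only: isotropic_splitting_def plus minus) simp
qed

text \<open>
  The reflection is \<open>2 p - 1\<close>, where \<open>p\<close> is the projection onto the first summand along the
  second; linearity of \<open>p\<close> comes from the uniqueness of the decomposition.
\<close>

lemma (in vector_space) reflection_exists:
  assumes U: "subspace U" and V: "subspace V" and int: "U \<inter> V = {0}"
    and sum: "{u + v | u v. u \<in> U \<and> v \<in> V} = UNIV"
  obtains M where "Vector_Spaces.linear scale scale M"
    "\<And>x. x \<in> U \<Longrightarrow> M x = x" "\<And>x. x \<in> V \<Longrightarrow> M x = - x"
proof -
  have "\<exists>u. u \<in> U \<and> x - u \<in> V" for x
  proof -
    have "x \<in> {u + v | u v. u \<in> U \<and> v \<in> V}"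
      using sum by simp
    then obtain u v where "x = u + v" "u \<in> U" "v \<in> V"
      by blast
    then show ?thesis
      by (intro exI[of _ u]) simp
  qed
  then obtain p where p: "\<And>x. p x \<in> U" "\<And>x. x - p x \<in> V"
    by metis
  have unique: "p x = u" if "u \<in> U" "x - u \<in> V" for x u
  proof -
    have "p x - u \<in> U"
      by (rule subspace_diff[OF U p(1) that(1)])
    moreover have "(x - u) - (x - p x) \<in> V"
      by (rule subspace_diff[OF V that(2) p(2)])
    ultimately have "p x - u \<in> U \<inter> V"
      by simp
    then show ?thesis
      using int by simp
  qed
  have p_add: "p (x + y) = p x + p y" for x y
    using subspace_add[OF U p(1) p(1), of x y] subspace_add[OF V p(2) p(2), of x y]
    by (intro unique) (simp_all add: algebra_simps)
  have p_scale: "p (scale c x) = scale c (p x)" for c x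
    using subspace_scale[OF U p(1), of c x] subspace_scale[OF V p(2), of c x]
    by (intro unique) (simp_all add: scale_right_diff_distrib)
  show thesis
  proof (rule that)
    show "Vector_Spaces.linear scale scale (\<lambda>x. p x + p x - x)"
      by (simp only: Vector_Spaces.linear_iff, intro conjI allI vector_space_axioms)
        (simp_all add: p_add p_scale scale_right_distrib scale_right_diff_distrib algebra_simps)
    show "p x + p x - x = x" if "x \<in> U" for x
      using unique[of x x] that subspace_0[OF V] by simp
    show "p x + p x - x = - x" if "x \<in> V" for x
      using unique[of 0 x] that subspace_0[OF U] by simp
  qed
qed

text \<open>
  Everything is evaluated on the components of the arguments. The summands turn out to be the full
  eigenspaces, since an eigenvector has twice its other component equal to 0; this transfers the
  equality of dimensions from the summands to the kernels.
\<close>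

lemma reflection_para_complex:
  fixes scale :: "'k::field \<Rightarrow> 'v::ab_group_add \<Rightarrow> 'v"
  assumes quad: "quadratic_pre_lie_algebra scale prd \<omega>"
    and split: "isotropic_splitting scale prd \<omega> U V"
    and lin: "Vector_Spaces.linear scale scale N"
    and NU: "\<And>x. x \<in> U \<Longrightarrow> N x = x" and NV: "\<And>x. x \<in> V \<Longrightarrow> N x = - x"
    and two: "(2::'k) \<noteq> 0"
  shows "para_complex_quadratic_pre_lie_algebra scale prd \<omega> N"
proof -
  interpret quadratic_pre_lie_algebra scale prd \<omega> by fact
  interpret N: Vector_Spaces.linear scale scale N by fact
  interpret L: Vector_Spaces.linear scale scale "\<lambda>x. prd x y" for y by (rule linear_prd_left)
  interpret R: Vector_Spaces.linear scale scale "\<lambda>y. prd x y" for x by (rule linear_prd_right)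
  interpret l: Vector_Spaces.linear scale "(*)" "\<lambda>x. \<omega> x y" for y by (rule linear_form_left)
  interpret r: Vector_Spaces.linear scale "(*)" "\<lambda>y. \<omega> x y" for x by (rule linear_form_right)
  from split have prdU: "\<And>x y. x \<in> U \<Longrightarrow> y \<in> U \<Longrightarrow> prd x y \<in> U"
    and prdV: "\<And>x y. x \<in> V \<Longrightarrow> y \<in> V \<Longrightarrow> prd x y \<in> V"
    and isoU: "\<And>x y. x \<in> U \<Longrightarrow> y \<in> U \<Longrightarrow> \<omega> x y = 0"
    and isoV: "\<And>x y. x \<in> V \<Longrightarrow> y \<in> V \<Longrightarrow> \<omega> x y = 0"
    and dims: "dim U = dim V"
    and sum: "{u + v | u v. u \<in> U \<and> v \<in> V} = UNIV"
    by (auto simp: isotropic_splitting_def pre_lie_subalgebra_def isotropic_def)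
  have decomp: "\<exists>u v. x = u + v \<and> u \<in> U \<and> v \<in> V" for x
    using sum by blast
  have N_sum: "N (u + v) = u - v" if "u \<in> U" "v \<in> V" for u v
    by (simp add: N.add NU NV that)
  have inv: "N (N x) = x" for x
  proof -
    obtain u v where "x = u + v" "u \<in> U" "v \<in> V"
      using decomp by blast
    then show ?thesis
      by (simp add: N_sum N.diff NU NV)
  qed
  have fixed: "x \<in> U" if "N x = x" for x
  proof -
    obtain u v where *: "x = u + v" "u \<in> U" "v \<in> V"
      using decomp by blast
    then have "v + v = 0"
      using that by (simp add: N_sum algebra_simps)
    then have "v = 0"
      by (rule add_self_eq_0[OF two])
    then show ?thesis
      using * by simp
  qed
  have antifixed: "x \<in> V" if "N x = - x" for x
  proof -
    obtain u v where *: "x = u + v" "u \<in> U" "v \<in> V"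
      using decomp by blast
    then have "u + u = 0"
      using that by (simp add: N_sum eq_neg_iff_add_eq_0 algebra_simps)
    then have "u = 0"
      by (rule add_self_eq_0[OF two])
    then show ?thesis
      using * by simp
  qed
  have kernels: "{x. N x + x = 0} = V" "{x. N x - x = 0} = U"
    using fixed antifixed NU NV by (auto simp: eq_neg_iff_add_eq_0)
  show ?thesis
  proof unfold_locales
    show "prd (N x) (N y) = N (prd (N x) y + prd x (N y) - N (prd x y))" for x y
    proof -
      obtain u v u' v' where x: "x = u + v" "u \<in> U" "v \<in> V"
        and y: "y = u' + v'" "u' \<in> U" "v' \<in> V"
        using decomp by meson
      \<comment> \<open>The mixed products cancel in this sum, so closure of the two summands under the
        product is enough to evaluate \<open>N\<close> on it.\<close>
      have "prd (N x) y + prd x (N y) = (prd u u' + prd u u') - (prd v v' + prd v v')"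
        using x y by (simp add: N_sum L.add L.diff R.add R.diff algebra_simps)
      moreover have "N \<dots> = (prd u u' + prd u u') + (prd v v' + prd v v')"
        using x y by (simp add: N.add N.diff NU NV prdU prdV)
      ultimately have "N (prd (N x) y + prd x (N y) - N (prd x y)) =
          (prd u u' + prd u u') + (prd v v' + prd v v') - prd x y"
        by (simp only: N.diff inv)
      also have "\<dots> = prd (N x) (N y)"
        using x y by (simp add: N_sum L.add L.diff R.add R.diff algebra_simps)
      finally show ?thesis ..
    qed
    show "\<omega> (N x) y = - \<omega> x (N y)" for x y
    proof -
      obtain u v u' v' where "x = u + v" "u \<in> U" "v \<in> V" "y = u' + v'" "u' \<in> U" "v' \<in> V"
        using decomp by meson
      then show ?thesis
        by (simp add: N_sum l.add l.diff r.add r.diff isoU isoV)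
    qed
    show "N (N x) = x" for x by (rule inv)
    show "dim {x. N x + x = 0} = dim {x. N x - x = 0}"
      by (simp only: kernels dims)
  qed
qed

text \<open>
  A splitting determines its operator and conversely, which is why the equivalence holds both for
  a prescribed operator with prescribed eigenspaces and for existence of some operator.
\<close>

theorem proposition7p6:
  fixes scale :: "'k::{alg_closed_field, field_char_0} \<Rightarrow> 'v::ab_group_add \<Rightarrow> 'v"
    and Basis :: "'v set"
    and prd :: "'v \<Rightarrow> 'v \<Rightarrow> 'v"
    and \<omega> :: "'v \<Rightarrow> 'v \<Rightarrow> 'k"
    and N :: "'v \<Rightarrow> 'v"
  assumes "finite_dimensional_vector_space scale Basis"
    and "quadratic_pre_lie_algebra scale prd \<omega>"
    and "nijenhuis_operator scale prd N"
  shows "(para_complex_quadratic_pre_lie_algebra scale prd \<omega> N \<longleftrightarrow>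
            (\<exists>gp gm. isotropic_splitting scale prd \<omega> gp gm \<and>
               (\<forall>x\<in>gp. N x = x) \<and> (\<forall>x\<in>gm. N x = - x))) \<and>
         ((\<exists>M. para_complex_quadratic_pre_lie_algebra scale prd \<omega> M) \<longleftrightarrow>
            (\<exists>gp gm. isotropic_splitting scale prd \<omega> gp gm))"
proof -
  interpret nijenhuis_operator scale prd N by fact
  have two: "(2::'k) \<noteq> 0"
    by simp
  have to_splitting: "\<exists>gp gm. isotropic_splitting scale prd \<omega> gp gm \<and>
      (\<forall>x\<in>gp. M x = x) \<and> (\<forall>x\<in>gm. M x = - x)"
    if "para_complex_quadratic_pre_lie_algebra scale prd \<omega> M" for M
    using eigenspaces_splitting[OF that two] by blast
  have from_splitting: "para_complex_quadratic_pre_lie_algebra scale prd \<omega> N"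
    if "isotropic_splitting scale prd \<omega> gp gm" "\<forall>x\<in>gp. N x = x" "\<forall>x\<in>gm. N x = - x" for gp gm
    using reflection_para_complex[OF assms(2) that(1) linear_operator _ _ two] that(2,3) by blast
  have exists_operator: "\<exists>M. para_complex_quadratic_pre_lie_algebra scale prd \<omega> M"
    if splitting: "isotropic_splitting scale prd \<omega> gp gm" for gp gm
  proof -
    obtain M where "Vector_Spaces.linear scale scale M"
      "\<And>x. x \<in> gp \<Longrightarrow> M x = x" "\<And>x. x \<in> gm \<Longrightarrow> M x = - x"
      using splitting reflection_exists[of gp gm]
      unfolding isotropic_splitting_def pre_lie_subalgebra_def by blast
    then show ?thesis
      using reflection_para_complex[OF assms(2) splitting _ _ _ two] by blast
  qed
  show ?thesis
    using to_splitting from_splitting exists_operator by blast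
qed

end
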